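(* Let $I\subset\mathbb{R}$ be an open interval, $n\in\mathbb{N}$, $\alpha,\beta\in\,]-1,+\infty[$ and $f\in C^{n+1}(I)$. A family of central estimators of $f^{(n)}$ is given by $$\forall x\in I_h,\quad D^{(n)}_{h,\alpha,\beta}f(x)=\frac{1}{h^{n}}\int_{-1}^{1}\rho_{n,\alpha,\beta}(t)\,f(x+ht)\,dt,$$ where $$\rho_{n,\alpha,\beta}(t)=\frac{2^{-(n+\alpha+\beta+1)}\,n!}{B(n+\alpha+1,n+\beta+1)}\,P_n^{(\alpha,\beta)}(t)\,w_{\alpha,\beta}(t),\qquad B(n+\alpha+1,n+\beta+1)=\frac{\Gamma(n+\alpha+1)\,\Gamma(n+\beta+1)}{\Gamma(2n+\alpha+\beta+2)}.$$ Moreover, $D^{(n)}_{h,\alpha,\beta}f(x)=f^{(n)}(x)+O(h)$ (as $h\to0^+$).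
   Context: $\mathbb{N}$ includes $0$. For $h>0$, $I_h:=\{x\in I:\ [x-h,x+h]\subset I\}$. For $\alpha,\beta>-1$ the $n$-th order Jacobi polynomial is $$P_n^{(\alpha,\beta)}(t)=\sum_{j=0}^{n}\binom{n+\alpha}{j}\binom{n+\beta}{n-j}\left(\frac{t-1}{2}\right)^{n-j}\left(\frac{t+1}{2}\right)^{j}$$ (generalized binomial coefficients with real upper entry), and $w_{\alpha,\beta}(t)=(1-t)^{\alpha}(1+t)^{\beta}$ is the weight function. *)

theory Defs
  imports "HOL-Analysis.Analysis" "HOL-Library.Landau_Symbols"
begin

text \<open>
  The class \<open>C\<^sup>k(S)\<close>. It is meant for open \<open>S\<close>, where the iterates of \<^const>\<open>deriv\<close>
  at points of \<open>S\<close> depend only on the restriction of \<open>f\<close> to \<open>S\<close>.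
\<close>

definition C_diff_on :: "nat \<Rightarrow> (real \<Rightarrow> real) \<Rightarrow> real set \<Rightarrow> bool" where
  "C_diff_on k f S \<longleftrightarrow>
     (\<forall>j<k. (deriv ^^ j) f differentiable_on S) \<and>
     (\<forall>j\<le>k. continuous_on S ((deriv ^^ j) f))"

definition inner_points :: "real set \<Rightarrow> real \<Rightarrow> real set" where
  "inner_points I h = {x \<in> I. {x - h..x + h} \<subseteq> I}"

definition jacobi_poly :: "nat \<Rightarrow> real \<Rightarrow> real \<Rightarrow> real \<Rightarrow> real" where
  "jacobi_poly n \<alpha> \<beta> t =
     (\<Sum>j=0..n. ((real n + \<alpha>) gchoose j) * ((real n + \<beta>) gchoose (n - j)) *
        ((t - 1) / 2) ^ (n - j) * ((t + 1) / 2) ^ j)"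

text \<open>
  At the endpoints \<open>-1\<close> and \<open>1\<close> the convention \<open>0 powr a = 0\<close> gives the weight the value
  \<open>0\<close>, whatever the exponents are; this does not affect integrals.
\<close>

definition jacobi_weight :: "real \<Rightarrow> real \<Rightarrow> real \<Rightarrow> real" where
  "jacobi_weight \<alpha> \<beta> t = (1 - t) powr \<alpha> * (1 + t) powr \<beta>"

definition jacobi_kernel :: "nat \<Rightarrow> real \<Rightarrow> real \<Rightarrow> real \<Rightarrow> real" where
  "jacobi_kernel n \<alpha> \<beta> t =
     2 powr (- (real n + \<alpha> + \<beta> + 1)) * fact n / Beta (real n + \<alpha> + 1) (real n + \<beta> + 1) *
     jacobi_poly n \<alpha> \<beta> t * jacobi_weight \<alpha> \<beta> t"

definition jacobi_estimator ::
  "nat \<Rightarrow> real \<Rightarrow> real \<Rightarrow> real \<Rightarrow> (real \<Rightarrow> real) \<Rightarrow> real \<Rightarrow> real" where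
  "jacobi_estimator n \<alpha> \<beta> h f x =
     1 / h ^ n * (LINT t:{-1..1}|lborel. jacobi_kernel n \<alpha> \<beta> t * f (x + h * t))"

end

theory Submission
  imports Defs
begin

text \<open>
  The kernel \<open>\<rho>\<close> integrates \<open>t\<^sup>m\<close> over \<open>[-1,1]\<close> to \<open>0\<close> for \<open>m < n\<close> and to \<open>n!\<close> for
  \<open>m = n\<close>. Hence, if \<open>f (x + h t)\<close> is replaced by its Taylor polynomial of degree \<open>n\<close> in \<open>h t\<close>,
  every term but the last integrates to zero, and the last gives exactly \<open>h\<^sup>n f\<^sup>(\<^sup>n\<^sup>)(x)\<close>. The
  Taylor remainder is at most a constant times \<open>h\<^sup>n\<^sup>+\<^sup>1\<close>, uniformly in \<open>t\<close>, because the derivative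
  of order \<open>n + 1\<close> is bounded on compact subintervals. Dividing by \<open>h\<^sup>n\<close> leaves an error
  \<open>O(h)\<close>, and convergence follows. This part (\<open>moment_kernel_estimate\<close>) works for any
  integrable kernel with these moments.

  The classical way to such moments is the Rodrigues formula with \<open>n\<close> integrations by parts.
  The Beta function gives them directly, with no boundary terms to discuss when an exponent
  of the weight is negative. Against \<open>(1 + t)\<^sup>m\<close>, every summand of the Jacobi polynomial
  gives a Beta integral. The Gamma factors that depend on the summation index \<open>j\<close> almost cancel
  against the generalized binomial coefficients: up to a common factor, what is left is
  \<open>\<Sum>j\<le>n. (-1)\<^sup>n\<^sup>-\<^sup>j (n choose j) (\<beta> + 1 + j)(\<beta> + 2 + j) \<dots> (\<beta> + m + j)\<close>, the \<open>n\<close>-th finite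
  difference of a monic polynomial of degree \<open>m\<close> in \<open>j\<close>. It is \<open>0\<close> for \<open>m < n\<close> and
  \<open>n!\<close> for \<open>m = n\<close> (\<open>alternating_sum_pochhammer\<close>); the constant in the kernel
  normalizes the common factor. Expanding \<open>t\<^sup>m = ((1 + t) - 1)\<^sup>m\<close> then gives the moments about
  \<open>0\<close> (\<open>jacobi_kernel_moment\<close>).
\<close>

section \<open>Integrals over the interval from -1 to 1\<close>

text \<open>
  Joining integrability and value in one predicate lets finite linear combinations of
  integrals be evaluated without separate integrability proofs.
\<close>

abbreviation has_integral_pm1 :: "(real \<Rightarrow> real) \<Rightarrow> real \<Rightarrow> bool" where
  "has_integral_pm1 g J \<equiv>
     has_bochner_integral lborel (\<lambda>t. indicator {-1..1} t *\<^sub>R g t) J"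

lemma has_integral_pm1_iff:
  "has_integral_pm1 g J \<longleftrightarrow>
     set_integrable lborel {-1..1} g \<and> (LINT t:{-1..1}|lborel. g t) = J"
  by (simp add: has_bochner_integral_iff set_integrable_def set_lebesgue_integral_def)

lemma has_integral_pm1_cong:
  assumes "\<And>t. t \<in> {-1..1} \<Longrightarrow> g t = k t" and "J = J'"
  shows "has_integral_pm1 g J \<longleftrightarrow> has_integral_pm1 k J'"
proof -
  have "(\<lambda>t. indicator {-1..1} t *\<^sub>R g t) = (\<lambda>t. indicator {-1..1} t *\<^sub>R k t)"
    using assms(1) by (auto simp: fun_eq_iff indicator_def)
  then show ?thesis using assms(2) by simp
qed

lemma has_integral_pm1_sum:
  assumes "\<And>j. j \<in> A \<Longrightarrow> has_integral_pm1 (g j) (J j)"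
  shows "has_integral_pm1 (\<lambda>t. \<Sum>j\<in>A. g j t) (\<Sum>j\<in>A. J j)"
  using has_bochner_integral_sum[OF assms] by (simp add: sum_distrib_left)

lemma has_integral_pm1_cmult:
  assumes "has_integral_pm1 g J"
  shows "has_integral_pm1 (\<lambda>t. c * g t) (c * J)"
  using has_bochner_integral_mult_right[of c, OF assms] by (simp add: mult_ac)

text \<open>
  A continuous function is bounded on a compact interval, so the product is dominated by a
  multiple of the integrable factor.
\<close>

lemma set_integrable_mult_continuous:
  fixes \<rho> g :: "real \<Rightarrow> real"
  assumes \<rho>: "set_integrable lborel {a..b} \<rho>" and g: "continuous_on {a..b} g"
  shows "set_integrable lborel {a..b} (\<lambda>t. \<rho> t * g t)"
proof -
  have "compact (g ` {a..b})"
    using g by (intro compact_continuous_image) auto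
  then obtain C where C: "\<And>t. t \<in> {a..b} \<Longrightarrow> \<bar>g t\<bar> \<le> C"
    using compact_imp_bounded by (fastforce simp: bounded_iff)
  show ?thesis
  proof (rule set_integrable_bound)
    show "set_integrable lborel {a..b} (\<lambda>t. C * \<rho> t)"
      using \<rho> by simp
    have "(\<lambda>t. (indicator {a..b} t *\<^sub>R \<rho> t) * (indicator {a..b} t *\<^sub>R g t)) \<in> borel_measurable lborel"
    proof (rule borel_measurable_times)
      show "(\<lambda>t. indicator {a..b} t *\<^sub>R \<rho> t) \<in> borel_measurable lborel"
        using \<rho> unfolding set_integrable_def by (rule borel_measurable_integrable)
      show "(\<lambda>t. indicator {a..b} t *\<^sub>R g t) \<in> borel_measurable lborel"
        using borel_measurable_continuous_on_indicator[OF _ g] by simp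
    qed
    moreover have "(\<lambda>t. (indicator {a..b} t *\<^sub>R \<rho> t) * (indicator {a..b} t *\<^sub>R g t)) =
        (\<lambda>t. indicator {a..b} t *\<^sub>R (\<rho> t * g t))"
      by (auto simp: indicator_def)
    ultimately show "set_borel_measurable lborel {a..b} (\<lambda>t. \<rho> t * g t)"
      unfolding set_borel_measurable_def by simp
    have "\<bar>\<rho> t\<bar> * \<bar>g t\<bar> \<le> \<bar>C\<bar> * \<bar>\<rho> t\<bar>" if "t \<in> {a..b}" for t
      using C[OF that] by (subst mult.commute, intro mult_right_mono) auto
    then show "AE t in lborel. t \<in> {a..b} \<longrightarrow> norm (\<rho> t * g t) \<le> norm (C * \<rho> t)"
      by (auto simp: abs_mult)
  qed
qed

section \<open>Finite differences of rising factorials\<close>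

text \<open>
  The sum is the \<open>n\<close>-th forward difference at \<open>x\<close> of the rising factorial of order \<open>m\<close>. One forward
  difference lowers the order: the rising factorial of order \<open>m\<close> goes to \<open>m\<close> times the one of order
  \<open>m - 1\<close>, based at \<open>x + 1\<close>. So the induction on \<open>n\<close> lowers \<open>n\<close> and \<open>m\<close> together.
\<close>

lemma alternating_sum_pochhammer:
  fixes x :: real
  assumes "m \<le> n"
  shows "(\<Sum>j\<le>n. (- 1) ^ (n - j) * real (n choose j) * pochhammer (x + real j) m) =
           (if m = n then fact n else 0)"
  using assms
proof (induction n arbitrary: m x)
  case 0
  then show ?case by simp
next
  case (Suc n)
  define p where "p = (\<lambda>j. pochhammer (x + real j) m)"
  \<comment> \<open>Pascal's rule splits the sum into two alternating sums with the coefficients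
    \<open>n choose j\<close>, one at \<open>p (Suc j)\<close> and one at \<open>- p j\<close>.\<close>
  have "(\<Sum>j\<le>Suc n. (- 1) ^ (Suc n - j) * real (Suc n choose j) * p j) =
      (\<Sum>j\<le>n. (- 1) ^ (n - j) * real (n choose j) * p (Suc j)) +
      ((- 1) ^ Suc n * p 0 + (\<Sum>j\<le>n. (- 1) ^ (n - j) * real (n choose Suc j) * p (Suc j)))"
    unfolding sum.atMost_Suc_shift by (simp add: algebra_simps sum.distrib)
  also have "(- 1) ^ Suc n * p 0 + (\<Sum>j\<le>n. (- 1) ^ (n - j) * real (n choose Suc j) * p (Suc j)) =
      (\<Sum>j\<le>Suc n. (- 1) ^ (Suc n - j) * real (n choose j) * p j)"
    unfolding sum.atMost_Suc_shift by simp
  also have "\<dots> = (\<Sum>j\<le>n. - ((- 1) ^ (n - j) * real (n choose j) * p j))"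
    unfolding sum.atMost_Suc by (simp add: Suc_diff_le)
  also have "(\<Sum>j\<le>n. (- 1) ^ (n - j) * real (n choose j) * p (Suc j)) + \<dots> =
      (\<Sum>j\<le>n. (- 1) ^ (n - j) * real (n choose j) * (p (Suc j) - p j))"
    unfolding sum.distrib [symmetric] by (simp add: right_diff_distrib)
  finally have step: "(\<Sum>j\<le>Suc n. (- 1) ^ (Suc n - j) * real (Suc n choose j) * p j) =
      (\<Sum>j\<le>n. (- 1) ^ (n - j) * real (n choose j) * (p (Suc j) - p j))" .
  show ?case
  proof (cases m)
    case 0
    then show ?thesis using step by (simp add: p_def)
  next
    case (Suc k)
    have diff: "p (Suc j) - p j = real m * pochhammer ((x + 1) + real j) k" for j
      unfolding p_def Suc pochhammer_rec[of "x + real j"] pochhammer_rec'[of "x + real (Suc j)"]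
      by (simp add: algebra_simps)
    have "(\<Sum>j\<le>n. (- 1) ^ (n - j) * real (n choose j) * (p (Suc j) - p j)) =
        real m * (\<Sum>j\<le>n. (- 1) ^ (n - j) * real (n choose j) * pochhammer ((x + 1) + real j) k)"
      unfolding diff sum_distrib_left by (intro sum.cong) (simp_all add: mult_ac)
    also have "\<dots> = real m * (if k = n then fact n else 0)"
      using Suc.IH[of k "x + 1"] Suc.prems Suc by simp
    finally show ?thesis
      using step Suc by (simp add: p_def)
  qed
qed

section \<open>Beta integrals against the Jacobi weight\<close>

text \<open>
  Euler's Beta integral on \<open>[0,1]\<close> after the substitution \<open>u = (1 + t) / 2\<close>.
\<close>

lemma has_integral_pm1_Beta:
  fixes a b :: real
  assumes "a > 0" "b > 0"
  shows "has_integral_pm1 (\<lambda>t. ((1 - t) / 2) powr (a - 1) * ((1 + t) / 2) powr (b - 1)) (2 * Beta a b)"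
proof -
  let ?g = "\<lambda>u. indicator {0..1} u *\<^sub>R (u powr (b - 1) * (1 - u) powr (a - 1))"
  have "(LINT u:{0..1}|lborel. u powr (b - 1) * (1 - u) powr (a - 1)) = Beta b a"
    using set_borel_integral_eq_integral(2)[OF integrable_Beta] has_integral_Beta_real assms
    by (simp add: has_integral_iff)
  then have "has_bochner_integral lborel ?g (Beta b a)"
    using integrable_Beta[OF assms(2,1)]
    by (simp add: has_bochner_integral_iff set_integrable_def set_lebesgue_integral_def)
  then have "has_bochner_integral lborel (\<lambda>t. ?g (1 / 2 + 1 / 2 * t)) (Beta b a /\<^sub>R \<bar>1 / 2\<bar>)"
    by (subst (asm) lborel_has_bochner_integral_real_affine_iff[of "1 / 2" _ _ "1 / 2"]) simp_all
  moreover have "?g (1 / 2 + 1 / 2 * t) =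
      indicator {-1..1} t *\<^sub>R (((1 - t) / 2) powr (a - 1) * ((1 + t) / 2) powr (b - 1))" for t
  proof -
    have half: "1 / 2 + 1 / 2 * t = (1 + t) / 2" "1 - (1 + t) / 2 = (1 - t) / 2"
      by (simp_all add: field_simps)
    have "indicator {0..1} ((1 + t) / 2) = (indicator {-1..1} t :: real)"
      by (auto simp: indicator_def)
    then show ?thesis unfolding half by (simp only: mult_ac)
  qed
  ultimately show ?thesis
    by (simp add: Beta_commute)
qed

text \<open>
  At \<open>x = 0\<close> both sides vanish because \<open>0 powr a = 0\<close>, also when \<open>a + k = 0\<close>. Thus the identities
  for the Jacobi weight below hold at the endpoints of the interval as well.
\<close>

lemma powr_mult_power:
  fixes x :: real
  assumes "x \<ge> 0"
  shows "x powr a * x ^ k = x powr (a + real k)"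
  using assms by (cases "x = 0") (simp_all add: powr_add powr_realpow)

lemma jacobi_weight_has_integral:
  assumes "\<alpha> > -1" "\<beta> > -1"
  shows "has_integral_pm1 (\<lambda>t. jacobi_weight \<alpha> \<beta> t * ((1 - t) / 2) ^ i * ((1 + t) / 2) ^ k)
           (2 powr (\<alpha> + \<beta> + 1) * Beta (\<alpha> + real i + 1) (\<beta> + real k + 1))"
proof -
  have Beta_form: "has_integral_pm1 (\<lambda>t. 2 powr (\<alpha> + \<beta>) *
      (((1 - t) / 2) powr (\<alpha> + real i + 1 - 1) * ((1 + t) / 2) powr (\<beta> + real k + 1 - 1)))
      (2 powr (\<alpha> + \<beta>) * (2 * Beta (\<alpha> + real i + 1) (\<beta> + real k + 1)))"
    using assms by (intro has_integral_pm1_cmult has_integral_pm1_Beta) auto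
  have integrand: "2 powr (\<alpha> + \<beta>) *
      (((1 - t) / 2) powr (\<alpha> + real i + 1 - 1) * ((1 + t) / 2) powr (\<beta> + real k + 1 - 1)) =
      jacobi_weight \<alpha> \<beta> t * ((1 - t) / 2) ^ i * ((1 + t) / 2) ^ k" if "t \<in> {-1..1}" for t
  proof -
    have "jacobi_weight \<alpha> \<beta> t = 2 powr (\<alpha> + \<beta>) * (((1 - t) / 2) powr \<alpha> * ((1 + t) / 2) powr \<beta>)"
      using that by (simp add: jacobi_weight_def powr_divide powr_add)
    moreover have "((1 - t) / 2) powr (\<alpha> + real i + 1 - 1) = ((1 - t) / 2) powr \<alpha> * ((1 - t) / 2) ^ i"
      "((1 + t) / 2) powr (\<beta> + real k + 1 - 1) = ((1 + t) / 2) powr \<beta> * ((1 + t) / 2) ^ k"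
      using that by (subst powr_mult_power; simp)+
    ultimately show ?thesis by (simp only: mult_ac)
  qed
  have val: "2 powr (\<alpha> + \<beta>) * (2 * Beta (\<alpha> + real i + 1) (\<beta> + real k + 1)) =
      2 powr (\<alpha> + \<beta> + 1) * Beta (\<alpha> + real i + 1) (\<beta> + real k + 1)"
    by (simp add: powr_add)
  show ?thesis
    by (rule has_integral_pm1_cong[THEN iffD1, OF _ _ Beta_form]) (use integrand val in auto)
qed

section \<open>Moments of the Jacobi kernel\<close>

text \<open>
  The product is \<open>\<Gamma>(n + a + 1) / (j! \<Gamma>(n - j + a + 1)) * \<Gamma>(n - j + a + 1)\<close>. This is the
  cancellation that makes the moments of a Jacobi polynomial computable term by term.
\<close>

lemma gbinomial_mult_Gamma:
  fixes a :: real
  assumes "j \<le> n" "a > -1"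
  shows "((real n + a) gchoose j) * Gamma (a + real (n - j) + 1) = Gamma (real n + a + 1) / fact j"
proof -
  have pos: "a + real (n - j) + 1 > 0" using assms by simp
  have poch: "pochhammer (a + real (n - j) + 1) j = Gamma (a + real (n - j) + 1 + real j) / Gamma (a + real (n - j) + 1)"
    using pos by (intro pochhammer_Gamma) (auto elim!: nonpos_Ints_cases')
  have shift: "a + real (n - j) + 1 + real j = real n + a + 1"
      "real n + a - real j + 1 = a + real (n - j) + 1"
    using assms(1) by (simp_all add: of_nat_diff)
  have "Gamma (a + real (n - j) + 1) \<noteq> 0"
    using Gamma_real_pos[OF pos] by simp
  then show ?thesis
    unfolding gbinomial_pochhammer' shift(2) poch shift(1) by simp
qed

text \<open>
  Powers of \<open>1 + t\<close> are used in place of powers of \<open>t\<close> because they merge with the factor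
  \<open>(1 + t)\<^sup>j\<close> in the summands of the Jacobi polynomial, so that each term is a single Beta
  integral.
\<close>

lemma jacobi_kernel_shifted_moment:
  assumes "\<alpha> > -1" "\<beta> > -1" "m \<le> n"
  shows "has_integral_pm1 (\<lambda>t. jacobi_kernel n \<alpha> \<beta> t * (1 + t) ^ m) (if m = n then fact n else 0)"
proof -
  define K where "K = 2 powr (- (real n + \<alpha> + \<beta> + 1)) * fact n / Beta (real n + \<alpha> + 1) (real n + \<beta> + 1)"
  define c where "c = (\<lambda>j. ((real n + \<alpha>) gchoose j) * ((real n + \<beta>) gchoose (n - j)) * (- 1) ^ (n - j))"
  define B where "B = (\<lambda>j. Beta (\<alpha> + real (n - j) + 1) (\<beta> + real (j + m) + 1))"
  have "has_integral_pm1 (\<lambda>t. \<Sum>j\<le>n. (K * 2 ^ m * c j) *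
        (jacobi_weight \<alpha> \<beta> t * ((1 - t) / 2) ^ (n - j) * ((1 + t) / 2) ^ (j + m)))
      (\<Sum>j\<le>n. (K * 2 ^ m * c j) * (2 powr (\<alpha> + \<beta> + 1) * B j))"
    unfolding B_def using assms
    by (intro has_integral_pm1_sum has_integral_pm1_cmult jacobi_weight_has_integral)
  moreover have "(\<Sum>j\<le>n. (K * 2 ^ m * c j) *
        (jacobi_weight \<alpha> \<beta> t * ((1 - t) / 2) ^ (n - j) * ((1 + t) / 2) ^ (j + m))) =
      jacobi_kernel n \<alpha> \<beta> t * (1 + t) ^ m" for t
  proof -
    define u v where "u = (1 - t) / 2" and "v = (1 + t) / 2"
    have neg: "(t - 1) / 2 = - u" "(t + 1) / 2 = v" and double: "1 + t = 2 * v"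
      by (simp_all add: u_def v_def field_simps)
    show ?thesis
      unfolding jacobi_kernel_def K_def [symmetric] jacobi_poly_def c_def neg
        u_def [symmetric] v_def [symmetric]
      unfolding double
      by (simp add: sum_distrib_left sum_distrib_right atLeast0AtMost power_add
          power_mult_distrib power_minus [of u] mult_ac)
  qed
  moreover have "(\<Sum>j\<le>n. (K * 2 ^ m * c j) * (2 powr (\<alpha> + \<beta> + 1) * B j)) =
      (if m = n then fact n else 0)"
  proof -
    define G where "G = Gamma (real n + \<alpha> + 1) * Gamma (real n + \<beta> + 1) / (fact n * Gamma (\<alpha> + \<beta> + real (n + m) + 2))"
    \<comment> \<open>The denominator of the Beta function does not depend on \<open>j\<close>; only a binomial coefficient, a
      sign and a rising factorial in \<open>j\<close> remain.\<close>
    have cB: "c j * B j = G * ((- 1) ^ (n - j) * real (n choose j) * pochhammer ((\<beta> + 1) + real j) m)"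
      if "j \<le> n" for j
    proof -
      have pos: "\<beta> + 1 + real j > 0" using assms by simp
      have "Gamma (\<beta> + real (j + m) + 1) = Gamma (\<beta> + real j + 1) * pochhammer ((\<beta> + 1) + real j) m"
      proof -
        have A: "\<beta> + 1 + real j \<notin> \<int>\<^sub>\<le>\<^sub>0"
          using pos by (auto elim!: nonpos_Ints_cases')
        have nz: "Gamma (\<beta> + 1 + real j) \<noteq> 0"
          using Gamma_real_pos[OF pos] by simp
        have shape: "\<beta> + real (j + m) + 1 = \<beta> + 1 + real j + real m"
            "\<beta> + real j + 1 = \<beta> + 1 + real j"
          by simp_all
        show ?thesis
          unfolding shape pochhammer_Gamma[OF A] using nz by simp
      qed
      moreover have "\<alpha> + real (n - j) + 1 + (\<beta> + real (j + m) + 1) = \<alpha> + \<beta> + real (n + m) + 2"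
        using that by (simp add: of_nat_diff)
      ultimately have B: "B j = Gamma (\<alpha> + real (n - j) + 1) * (Gamma (\<beta> + real j + 1) *
          pochhammer ((\<beta> + 1) + real j) m) / Gamma (\<alpha> + \<beta> + real (n + m) + 2)"
        by (simp only: B_def Beta_def)
      have "c j * B j = (((real n + \<alpha>) gchoose j) * Gamma (\<alpha> + real (n - j) + 1)) *
          (((real n + \<beta>) gchoose (n - j)) * Gamma (\<beta> + real (n - (n - j)) + 1)) *
          (- 1) ^ (n - j) * pochhammer ((\<beta> + 1) + real j) m / Gamma (\<alpha> + \<beta> + real (n + m) + 2)"
        using that by (simp add: B c_def)
      also have "\<dots> = (Gamma (real n + \<alpha> + 1) / fact j) * (Gamma (real n + \<beta> + 1) / fact (n - j)) *
          (- 1) ^ (n - j) * pochhammer ((\<beta> + 1) + real j) m / Gamma (\<alpha> + \<beta> + real (n + m) + 2)"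
        using that assms by (subst (1 2) gbinomial_mult_Gamma) auto
      also have "\<dots> = G * ((- 1) ^ (n - j) * real (n choose j) * pochhammer ((\<beta> + 1) + real j) m)"
        using that by (simp add: G_def binomial_fact field_simps)
      finally show ?thesis .
    qed
    have "(\<Sum>j\<le>n. (K * 2 ^ m * c j) * (2 powr (\<alpha> + \<beta> + 1) * B j)) =
        K * 2 ^ m * 2 powr (\<alpha> + \<beta> + 1) * (\<Sum>j\<le>n. c j * B j)"
      unfolding sum_distrib_left by (intro sum.cong) (simp_all add: mult_ac)
    also have "(\<Sum>j\<le>n. c j * B j) =
        G * (\<Sum>j\<le>n. (- 1) ^ (n - j) * real (n choose j) * pochhammer ((\<beta> + 1) + real j) m)"
      unfolding sum_distrib_left by (intro sum.cong refl cB) simp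
    also have "\<dots> = G * (if m = n then fact n else 0)"
      using assms(3) by (subst alternating_sum_pochhammer) auto
    also have "K * 2 ^ m * 2 powr (\<alpha> + \<beta> + 1) * \<dots> = (if m = n then fact n else 0)"
    proof (cases "m = n")
      case True
      have "Gamma (real n + \<alpha> + 1) > 0" "Gamma (real n + \<beta> + 1) > 0"
          "Gamma (\<alpha> + \<beta> + real (n + n) + 2) > 0"
        using assms by (auto intro!: Gamma_real_pos)
      moreover have "real n + \<alpha> + 1 + (real n + \<beta> + 1) = \<alpha> + \<beta> + real (n + n) + 2"
        by simp
      ultimately have "G * fact n = Beta (real n + \<alpha> + 1) (real n + \<beta> + 1)"
          "Beta (real n + \<alpha> + 1) (real n + \<beta> + 1) \<noteq> 0"
        unfolding Beta_def G_def True by (simp_all only: ) (simp_all add: field_simps)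
      moreover have "2 powr (- (real n + \<alpha> + \<beta> + 1)) * 2 ^ n * 2 powr (\<alpha> + \<beta> + 1) = (1 :: real)"
        by (simp add: powr_realpow [symmetric] powr_add [symmetric])
      ultimately show ?thesis
        using True by (simp add: K_def field_simps)
    qed simp
    finally show ?thesis .
  qed
  ultimately show ?thesis by simp
qed

lemma jacobi_kernel_moment:
  assumes "\<alpha> > -1" "\<beta> > -1" "m \<le> n"
  shows "has_integral_pm1 (\<lambda>t. jacobi_kernel n \<alpha> \<beta> t * t ^ m) (if m = n then fact n else 0)"
proof -
  define d where "d = (\<lambda>i. real (m choose i) * (- 1) ^ (m - i))"
  have "has_integral_pm1 (\<lambda>t. \<Sum>i\<le>m. d i * (jacobi_kernel n \<alpha> \<beta> t * (1 + t) ^ i))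
      (\<Sum>i\<le>m. d i * (if i = n then fact n else 0))"
    using assms
    by (intro has_integral_pm1_sum has_integral_pm1_cmult jacobi_kernel_shifted_moment) auto
  moreover have "(\<Sum>i\<le>m. d i * (jacobi_kernel n \<alpha> \<beta> t * (1 + t) ^ i)) = jacobi_kernel n \<alpha> \<beta> t * t ^ m" for t
  proof -
    have "t ^ m = (\<Sum>i\<le>m. d i * (1 + t) ^ i)"
      using binomial_ring[of "1 + t" "-1" m] by (simp add: d_def mult_ac)
    then show ?thesis by (simp add: sum_distrib_left mult_ac)
  qed
  moreover have "(\<Sum>i\<le>m. d i * (if i = n then fact n else 0)) = (if m = n then fact n else 0)"
  proof -
    have "(\<Sum>i\<le>m. d i * (if i = n then fact n else 0)) = (\<Sum>i\<le>m. if i = n then d n * fact n else 0)"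
      by (intro sum.cong) auto
    also have "\<dots> = (if m = n then fact n else 0)"
      using assms(3) by (auto simp: d_def)
    finally show ?thesis .
  qed
  ultimately show ?thesis by simp
qed

section \<open>Taylor estimate for kernels with prescribed moments\<close>

lemma C_diff_on_has_derivative:
  assumes "open S" "C_diff_on k f S" "j < k" "y \<in> S"
  shows "((deriv ^^ j) f has_real_derivative (deriv ^^ Suc j) f y) (at y)"
  using assms unfolding C_diff_on_def
  by (auto simp: differentiable_on_eq_differentiable_at DERIV_deriv_iff_real_differentiable)

text \<open>
  The moments make the kernel map the Taylor polynomial \<open>T\<close> of \<open>f\<close> at \<open>x\<close> exactly to
  \<open>h\<^sup>n f\<^sup>(\<^sup>n\<^sup>)(x)\<close>, so the error comes from the Taylor remainder alone. It carries the factor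
  \<open>h\<^sup>n\<^sup>+\<^sup>1\<close>, of which division by \<open>h\<^sup>n\<close> leaves one \<open>h\<close>.
\<close>

lemma moment_kernel_estimate:
  fixes \<rho> f :: "real \<Rightarrow> real"
  assumes "open I" and C: "C_diff_on (n + 1) f I"
    and \<rho>: "set_integrable lborel {-1..1} \<rho>"
    and moments: "\<And>m. m \<le> n \<Longrightarrow>
      has_integral_pm1 (\<lambda>t. \<rho> t * t ^ m) (if m = n then fact n else 0)"
    and h: "h > 0" and x: "x \<in> inner_points I h"
    and M: "\<And>y. y \<in> {x - h..x + h} \<Longrightarrow> \<bar>(deriv ^^ Suc n) f y\<bar> \<le> M"
  shows "\<bar>1 / h ^ n * (LINT t:{-1..1}|lborel. \<rho> t * f (x + h * t)) - (deriv ^^ n) f x\<bar>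
           \<le> M / fact n * (LINT t:{-1..1}|lborel. \<bar>\<rho> t\<bar>) * h"
    and "set_integrable lborel {-1..1} (\<lambda>t. \<rho> t * f (x + h * t))"
proof -
  have sub: "{x - h..x + h} \<subseteq> I"
    using x by (simp add: inner_points_def)
  have in_seg: "x + h * t \<in> {x - h..x + h}" if "t \<in> {-1..1}" for t
  proof -
    have "h * t \<le> h * 1" "h * (-1) \<le> h * t"
      using that h by (intro mult_left_mono; simp)+
    then show ?thesis by simp
  qed
  have "continuous_on I f"
    using C by (auto simp: C_diff_on_def dest: spec[of _ 0])
  then have cont: "continuous_on {-1..1} (\<lambda>t. f (x + h * t))"
    by (rule continuous_on_compose2) (use in_seg sub in \<open>auto intro!: continuous_intros\<close>)
  show int_f: "set_integrable lborel {-1..1} (\<lambda>t. \<rho> t * f (x + h * t))"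
    by (rule set_integrable_mult_continuous[OF \<rho> cont])
  define T where "T = (\<lambda>t. \<Sum>i\<le>n. (deriv ^^ i) f x * (h * t) ^ i / fact i)"
  have remainder: "\<bar>f (x + h * t) - T t\<bar> \<le> M / fact n * h ^ Suc n" if "t \<in> {-1..1}" for t
  proof -
    have "norm ((deriv ^^ 0) f (x + h * t) - (\<Sum>i\<le>n. (deriv ^^ i) f x * ((x + h * t) - x) ^ i / fact i))
        \<le> M * norm ((x + h * t) - x) ^ Suc n / fact n"
    proof (rule field_Taylor[where S = "{x - h..x + h}"])
      show "((deriv ^^ i) f has_field_derivative (deriv ^^ Suc i) f y) (at y within {x - h..x + h})"
        if "y \<in> {x - h..x + h}" "i \<le> n" for i y
        using that sub
        by (intro has_field_derivative_at_within[OF C_diff_on_has_derivative[OF \<open>open I\<close> C]]) auto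
      show "norm ((deriv ^^ Suc n) f y) \<le> M" if "y \<in> {x - h..x + h}" for y
        using M[OF that] by simp
    qed (use h in_seg[OF that] in auto)
    also have "M * norm ((x + h * t) - x) ^ Suc n / fact n \<le> M * h ^ Suc n / fact n"
    proof -
      have "M \<ge> 0" using M[of x] h by force
      moreover have "norm ((x + h * t) - x) \<le> h"
        using in_seg[OF that] by auto
      ultimately show ?thesis
        by (intro divide_right_mono mult_left_mono power_mono) auto
    qed
    finally show ?thesis by (simp add: T_def)
  qed
  have int_T: "has_integral_pm1 (\<lambda>t. \<rho> t * T t) (h ^ n * (deriv ^^ n) f x)"
  proof -
    have "has_integral_pm1 (\<lambda>t. \<Sum>i\<le>n. ((deriv ^^ i) f x * h ^ i / fact i) * (\<rho> t * t ^ i))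
        (\<Sum>i\<le>n. ((deriv ^^ i) f x * h ^ i / fact i) * (if i = n then fact n else 0))"
      by (intro has_integral_pm1_sum has_integral_pm1_cmult moments) simp
    moreover have "(\<Sum>i\<le>n. ((deriv ^^ i) f x * h ^ i / fact i) * (\<rho> t * t ^ i)) = \<rho> t * T t" for t
      by (simp add: T_def sum_distrib_left power_mult_distrib mult_ac)
    moreover have "(\<Sum>i\<le>n. ((deriv ^^ i) f x * h ^ i / fact i) * (if i = n then fact n else 0)) =
        (\<Sum>i\<le>n. if i = n then h ^ n * (deriv ^^ n) f x else 0)"
      by (intro sum.cong) auto
    ultimately show ?thesis by simp
  qed
  then have \<rho>T: "set_integrable lborel {-1..1} (\<lambda>t. \<rho> t * T t)"
      "(LINT t:{-1..1}|lborel. \<rho> t * T t) = h ^ n * (deriv ^^ n) f x"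
    unfolding has_integral_pm1_iff by simp_all
  let ?L = "LINT t:{-1..1}|lborel. \<rho> t * f (x + h * t)"
  have int_R: "set_integrable lborel {-1..1} (\<lambda>t. \<rho> t * f (x + h * t) - \<rho> t * T t)"
    using int_f \<rho>T(1) by (rule set_integral_diff)
  have "?L - h ^ n * (deriv ^^ n) f x = (LINT t:{-1..1}|lborel. \<rho> t * f (x + h * t) - \<rho> t * T t)"
    using set_integral_diff(2)[OF int_f \<rho>T(1)] \<rho>T(2) by simp
  also have "\<bar>\<dots>\<bar> \<le> (LINT t:{-1..1}|lborel. \<bar>\<rho> t * f (x + h * t) - \<rho> t * T t\<bar>)"
    using set_integral_norm_bound[OF int_R] by simp
  also have "\<dots> \<le> (LINT t:{-1..1}|lborel. \<bar>\<rho> t\<bar> * (M / fact n * h ^ Suc n))"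
  proof (rule set_integral_mono)
    show "\<bar>\<rho> t * f (x + h * t) - \<rho> t * T t\<bar> \<le> \<bar>\<rho> t\<bar> * (M / fact n * h ^ Suc n)"
      if "t \<in> {-1..1}" for t
      unfolding right_diff_distrib [symmetric] abs_mult
      by (intro mult_left_mono remainder that) auto
  qed (use int_R \<rho> in \<open>auto intro: set_integrable_abs\<close>)
  also have "\<dots> = M / fact n * (LINT t:{-1..1}|lborel. \<bar>\<rho> t\<bar>) * h * h ^ n"
    by (simp add: mult_ac)
  finally have bound: "\<bar>?L - h ^ n * (deriv ^^ n) f x\<bar> \<le>
      M / fact n * (LINT t:{-1..1}|lborel. \<bar>\<rho> t\<bar>) * h * h ^ n" .
  have "1 / h ^ n * ?L - (deriv ^^ n) f x = (?L - h ^ n * (deriv ^^ n) f x) / h ^ n"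
    using h by (simp add: field_simps)
  then have "\<bar>1 / h ^ n * ?L - (deriv ^^ n) f x\<bar> = \<bar>?L - h ^ n * (deriv ^^ n) f x\<bar> / h ^ n"
    using h by (simp add: abs_divide)
  also have "\<dots> \<le> M / fact n * (LINT t:{-1..1}|lborel. \<bar>\<rho> t\<bar>) * h"
    using bound h by (subst pos_divide_le_eq) auto
  finally show "\<bar>1 / h ^ n * ?L - (deriv ^^ n) f x\<bar> \<le>
      M / fact n * (LINT t:{-1..1}|lborel. \<bar>\<rho> t\<bar>) * h" .
qed

section \<open>The central estimators\<close>

theorem proposition1:
  fixes I :: "real set" and n :: nat and \<alpha> \<beta> :: real and f :: "real \<Rightarrow> real"
  assumes "open I" and "is_interval I"
    and "\<alpha> > -1" and "\<beta> > -1"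
    and "C_diff_on (n + 1) f I"
  shows "(\<forall>h>0. \<forall>x\<in>inner_points I h.
            set_integrable lborel {-1..1} (\<lambda>t. jacobi_kernel n \<alpha> \<beta> t * f (x + h * t))) \<and>
         (\<forall>x\<in>I.
            (\<forall>\<^sub>F h in at_right 0. x \<in> inner_points I h) \<and>
            ((\<lambda>h. jacobi_estimator n \<alpha> \<beta> h f x) \<longlongrightarrow> (deriv ^^ n) f x) (at_right 0) \<and>
            (\<lambda>h. jacobi_estimator n \<alpha> \<beta> h f x - (deriv ^^ n) f x) \<in> O[at_right 0](\<lambda>h. h))"
proof (intro conjI allI impI ballI)
  let ?\<rho> = "jacobi_kernel n \<alpha> \<beta>"
  have moments: "has_integral_pm1 (\<lambda>t. ?\<rho> t * t ^ m) (if m = n then fact n else 0)" if "m \<le> n" for m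
    using jacobi_kernel_moment assms(3,4) that by blast
  have \<rho>: "set_integrable lborel {-1..1} ?\<rho>"
    using moments[of 0] unfolding has_integral_pm1_iff by simp
  have cont: "continuous_on I ((deriv ^^ Suc n) f)"
    using assms(5) unfolding C_diff_on_def by (auto simp del: funpow.simps)
  have bounded: "\<exists>M. \<forall>y\<in>{x - h..x + h}. \<bar>(deriv ^^ Suc n) f y\<bar> \<le> M"
    if "{x - h..x + h} \<subseteq> I" for x h
  proof -
    have "compact ((deriv ^^ Suc n) f ` {x - h..x + h})"
      using continuous_on_subset[OF cont that] by (intro compact_continuous_image) auto
    then show ?thesis
      using compact_imp_bounded by (fastforce simp: bounded_iff)
  qed
  show "set_integrable lborel {-1..1} (\<lambda>t. ?\<rho> t * f (x + h * t))"
    if h: "h > 0" and x: "x \<in> inner_points I h" for h x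
  proof -
    obtain M where "\<forall>y\<in>{x - h..x + h}. \<bar>(deriv ^^ Suc n) f y\<bar> \<le> M"
      using bounded[of x h] x unfolding inner_points_def by blast
    then show ?thesis
      using moment_kernel_estimate(2)[OF assms(1,5) \<rho> moments h x] by blast
  qed
  fix x assume x: "x \<in> I"
  obtain r where r: "r > 0" "{x - r..x + r} \<subseteq> I"
    using \<open>open I\<close> x unfolding open_contains_cball by (metis cball_eq_atLeastAtMost)
  have inner: "x \<in> inner_points I h" if "h < r" for h
    using that r x by (force simp: inner_points_def)
  have small: "\<forall>\<^sub>F h in at_right 0. 0 < h \<and> h < r"
    using r(1) by (auto simp: eventually_at_right_less eventually_at_right_field)
  then show "\<forall>\<^sub>F h in at_right 0. x \<in> inner_points I h"
    by eventually_elim (auto intro: inner)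
  \<comment> \<open>The bound is taken on the fixed segment of radius \<open>r\<close>, so that it does not depend on \<open>h\<close>.\<close>
  obtain M where M: "\<forall>y\<in>{x - r..x + r}. \<bar>(deriv ^^ Suc n) f y\<bar> \<le> M"
    using bounded[OF r(2)] by blast
  show O: "(\<lambda>h. jacobi_estimator n \<alpha> \<beta> h f x - (deriv ^^ n) f x) \<in> O[at_right 0](\<lambda>h. h)"
  proof (rule bigoI)
    show "\<forall>\<^sub>F h in at_right 0. norm (jacobi_estimator n \<alpha> \<beta> h f x - (deriv ^^ n) f x)
        \<le> M / fact n * (LINT t:{-1..1}|lborel. \<bar>?\<rho> t\<bar>) * norm h"
      using small
    proof eventually_elim
      case (elim h)
      then have "\<bar>(deriv ^^ Suc n) f y\<bar> \<le> M" if "y \<in> {x - h..x + h}" for y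
        using that by (intro bspec[OF M]) auto
      then show ?case
        using moment_kernel_estimate(1)[OF assms(1,5) \<rho> moments _ inner[of h], of M] elim
        by (simp add: jacobi_estimator_def)
    qed
  qed
  have "((\<lambda>h. jacobi_estimator n \<alpha> \<beta> h f x - (deriv ^^ n) f x) \<longlongrightarrow> 0) (at_right 0)"
  proof -
    obtain c where c: "\<forall>\<^sub>F h in at_right 0.
        norm (jacobi_estimator n \<alpha> \<beta> h f x - (deriv ^^ n) f x) \<le> c * norm h"
      using O by (elim landau_o.bigE)
    have "((\<lambda>h::real. c * norm h) \<longlongrightarrow> c * norm (0::real)) (at_right 0)"
      by (intro tendsto_intros)
    then show ?thesis
      by (intro Lim_null_comparison[OF c]) simp
  qed
  then show "((\<lambda>h. jacobi_estimator n \<alpha> \<beta> h f x) \<longlongrightarrow> (deriv ^^ n) f x) (at_right 0)"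
    by (rule LIM_zero_cancel)
qed

end
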